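(* Let $(p_n)_{n\in\mathbb N}$ be a sequence of pairwise distinct elements of $(0,1)$ converging to $\frac12$. On $X=\{0,1\}^{\mathbb N}$ consider the measures $\mu_n=(p_n\delta_1+(1-p_n)\delta_0)^{\otimes\mathbb N}$ and $\lambda=\sum_{n\in\mathbb N}\mu_n$ (an infinite $\sigma$-finite measure), and let $\alpha$ be the $\lambda$-preserving action of $\mathfrak S_\infty$ on $X$ by permutation of the coordinates. Then the spatial $\mathfrak S_\infty$-action $\alpha$ on $(X,\lambda)$ is not spatially isomorphic to any continuous measure-preserving $\mathfrak S_\infty$-action on a Polish space $Y$ endowed with a locally finite measure $\eta$.
   Context: $\mathfrak S_\infty$ is the Polish group of all permutations of $\mathbb N$, with the topology of pointwise convergence; it acts on $\{0,1\}^{\mathbb N}$ by $(\sigma\cdot x)_i=x_{\sigma^{-1}(i)}$. A spatial measure-preserving action of a Polish group $G$ on a standard Borel space with a $\sigma$-finite measure is a Borel map $G\times X\to X$ that is a genuine group action by measure-preserving bijections. Measure-preserving spatial $G$-actions $\alpha$ on $(X,\lambda)$ and $\beta$ on $(Y,\eta)$ are spatially isomorphic if there are a conull $\alpha(G)$-invariant Borel subset $X_0\subseteq X$ and a measure-preserving Borel injection $\Phi:X_0\to Y$ (that is, $\Phi_*(\lambda_{\restriction X_0})=\eta$) such that $\Phi(\alpha(g,x))=\beta(g,\Phi(x))$ for all $g\in G$ and all $x\in X_0$. A Borel measure on a Polish space is locally finite if every point has an open neighborhood of finite measure. A continuous action is one whose action map $G\times Y\to Y$ is continuous. *)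

theory Defs
  imports "HOL-Probability.Probability"
begin

definition Polish_space :: "'a topology \<Rightarrow> bool" where
  "Polish_space T \<longleftrightarrow> completely_metrizable_space T \<and> second_countable T"

definition borel_of :: "'a topology \<Rightarrow> 'a measure" where
  "borel_of T = sigma (topspace T) {U. openin T U}"

definition standard_borel :: "'a measure \<Rightarrow> bool" where
  "standard_borel M \<longleftrightarrow> (\<exists>T. Polish_space T \<and> sets M = sets (borel_of T))"

definition Sinf :: "(nat \<Rightarrow> nat) set" where
  "Sinf = {\<sigma>. bij \<sigma>}"

definition Sinf_top :: "(nat \<Rightarrow> nat) topology" where
  "Sinf_top = subtopology (product_topology (\<lambda>_. discrete_topology UNIV) UNIV) Sinf"

text \<open>Actions of the group of all permutations of the naturals (with composition) by measurable
  measure-preserving maps; joint measurability is not part of this definition. Each map is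
  automatically a bijection of \<open>space M\<close>, by the two action laws.\<close>

definition mp_action :: "'a measure \<Rightarrow> ((nat \<Rightarrow> nat) \<Rightarrow> 'a \<Rightarrow> 'a) \<Rightarrow> bool" where
  "mp_action M a \<longleftrightarrow>
     (\<forall>g\<in>Sinf. a g \<in> M \<rightarrow>\<^sub>M M \<and> distr M M (a g) = M) \<and>
     (\<forall>x\<in>space M. a id x = x) \<and>
     (\<forall>g\<in>Sinf. \<forall>h\<in>Sinf. \<forall>x\<in>space M. a (g \<circ> h) x = a g (a h x))"

definition spatial_action :: "'a measure \<Rightarrow> ((nat \<Rightarrow> nat) \<Rightarrow> 'a \<Rightarrow> 'a) \<Rightarrow> bool" where
  "spatial_action M a \<longleftrightarrow>
     standard_borel M \<and> sigma_finite_measure M \<and> mp_action M a \<and>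
     (\<lambda>(g, x). a g x) \<in> borel_of Sinf_top \<Otimes>\<^sub>M M \<rightarrow>\<^sub>M M"

definition spatially_isomorphic ::
  "'a measure \<Rightarrow> ((nat \<Rightarrow> nat) \<Rightarrow> 'a \<Rightarrow> 'a) \<Rightarrow> 'b measure \<Rightarrow> ((nat \<Rightarrow> nat) \<Rightarrow> 'b \<Rightarrow> 'b) \<Rightarrow> bool" where
  "spatially_isomorphic M a N b \<longleftrightarrow>
     (\<exists>X0 \<Phi>. X0 \<in> sets M \<and> space M - X0 \<in> null_sets M \<and>
        (\<forall>g\<in>Sinf. a g ` X0 = X0) \<and>
        \<Phi> \<in> restrict_space M X0 \<rightarrow>\<^sub>M N \<and> inj_on \<Phi> X0 \<and>
        distr (restrict_space M X0) N \<Phi> = N \<and>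
        (\<forall>g\<in>Sinf. \<forall>x\<in>X0. \<Phi> (a g x) = b g (\<Phi> x)))"

definition locally_finite_measure :: "'a topology \<Rightarrow> 'a measure \<Rightarrow> bool" where
  "locally_finite_measure T N \<longleftrightarrow>
     (\<forall>x\<in>topspace T. \<exists>U. openin T U \<and> x \<in> U \<and> emeasure N U < \<infinity>)"

definition continuous_action :: "'a topology \<Rightarrow> ((nat \<Rightarrow> nat) \<Rightarrow> 'a \<Rightarrow> 'a) \<Rightarrow> bool" where
  "continuous_action T b \<longleftrightarrow> continuous_map (prod_topology Sinf_top T) T (\<lambda>(g, y). b g y)"

text \<open>Points of \<open>{0,1}\<^sup>\<nat>\<close> are functions \<open>nat \<Rightarrow> bool\<close>, with \<open>True\<close> in the role of 1.
  The \<open>\<sigma>\<close>-algebra is the product one, which is the Borel \<open>\<sigma>\<close>-algebra of the product topology.\<close>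

definition coin_measure :: "real \<Rightarrow> (nat \<Rightarrow> bool) measure" where
  "coin_measure p = (\<Pi>\<^sub>M i\<in>UNIV. measure_pmf (bernoulli_pmf p))"

definition sum_coin_measure :: "(nat \<Rightarrow> real) \<Rightarrow> (nat \<Rightarrow> bool) measure" where
  "sum_coin_measure p =
     measure_of UNIV (sets (\<Pi>\<^sub>M i\<in>UNIV. count_space UNIV))
       (\<lambda>A. \<Sum>n. emeasure (coin_measure (p n)) A)"

definition perm_action :: "(nat \<Rightarrow> nat) \<Rightarrow> (nat \<Rightarrow> bool) \<Rightarrow> (nat \<Rightarrow> bool)" where
  "perm_action \<sigma> x = (\<lambda>i. x (inv \<sigma> i))"

text \<open>\<open>measure_of\<close> returns the zero measure unless the given set function is countably additive;
  here it is.\<close>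

lemma sets_coin_measure: "sets (coin_measure p) = sets (\<Pi>\<^sub>M i\<in>UNIV. count_space UNIV)"
  unfolding coin_measure_def by (intro sets_PiM_cong) auto

lemma emeasure_sum_coin_measure:
  assumes "A \<in> sets (\<Pi>\<^sub>M i\<in>UNIV. count_space UNIV)"
  shows "emeasure (sum_coin_measure p) A = (\<Sum>n. emeasure (coin_measure (p n)) A)"
proof (rule emeasure_measure_of[OF sum_coin_measure_def])
  let ?S = "sets (\<Pi>\<^sub>M i\<in>(UNIV::nat set). count_space (UNIV::bool set))"
  show "?S \<subseteq> Pow UNIV" by auto
  have eq: "sets (sum_coin_measure p) = ?S"
    unfolding sum_coin_measure_def
    by (subst sets_measure_of) (auto simp: sets.sigma_sets_eq[of "\<Pi>\<^sub>M i\<in>(UNIV::nat set). count_space (UNIV::bool set)", simplified space_PiM, simplified])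
  show "A \<in> sets (sum_coin_measure p)" using assms eq by simp
  show "positive (sets (sum_coin_measure p)) (\<lambda>A. \<Sum>n. emeasure (coin_measure (p n)) A)"
    by (simp add: positive_def)
  show "countably_additive (sets (sum_coin_measure p)) (\<lambda>A. \<Sum>n. emeasure (coin_measure (p n)) A)"
  proof (rule countably_additiveI)
    fix B :: "nat \<Rightarrow> (nat \<Rightarrow> bool) set"
    assume B: "range B \<subseteq> sets (sum_coin_measure p)" "disjoint_family B"
    have "(\<Sum>i. \<Sum>n. emeasure (coin_measure (p n)) (B i)) =
          (\<Sum>n. \<Sum>i. emeasure (coin_measure (p n)) (B i))"
      by (simp add: nn_integral_count_space_nat[symmetric] nn_integral_fst_count_space
          nn_integral_snd_count_space pair_sigma_finite.Fubini)
         (rule pair_sigma_finite.Fubini', auto simp: pair_sigma_finite_def sigma_finite_measure_count_space)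
    also have "\<dots> = (\<Sum>n. emeasure (coin_measure (p n)) (\<Union>i. B i))"
      using B by (intro arg_cong[where f=suminf] ext suminf_emeasure)
        (auto simp: eq sets_coin_measure)
    finally show "(\<Sum>i. \<Sum>n. emeasure (coin_measure (p n)) (B i)) =
        (\<Sum>n. emeasure (coin_measure (p n)) (\<Union>i. B i))" .
  qed
qed

end

theory Submission
  imports Defs
begin

text \<open>The sequences with infinitely many 0s and infinitely many 1s form a single conull orbit, on
  which the cylinder of length \<open>k\<close> around \<open>x\<close> is exactly the orbit of \<open>x\<close> under the pointwise
  stabiliser of \<open>{..<k}\<close>. Hence an equivariant map into a continuous action is automatically
  continuous on this orbit, so every neighbourhood of the image of \<open>x\<close> pulls back to a set that
  contains, up to a null set, a cylinder around \<open>x\<close>. Since \<open>p n\<close> tends to \<open>1/2\<close>, the measures of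
  this cylinder under the \<open>n\<close>-th coin measures are bounded away from 0, and their sum is infinite.
  The sum measure is nevertheless \<open>\<sigma>\<close>-finite, because by the law of large numbers the coin measures
  live on the disjoint sets where the frequency of 1s is \<open>p n\<close>.\<close>

section \<open>The product topology on sequences\<close>

abbreviation seq_top :: "(nat \<Rightarrow> 'a) topology" where
  "seq_top \<equiv> product_topology (\<lambda>_. discrete_topology UNIV) UNIV"

abbreviation seq_space :: "(nat \<Rightarrow> bool) measure" where
  "seq_space \<equiv> \<Pi>\<^sub>M i\<in>UNIV. count_space UNIV"

text \<open>The value type is left open because cylinders serve twice: for 0-1 sequences and for
  permutations, where the bijections in \<open>cylinder id k\<close> form the pointwise stabiliser
  of \<open>{..<k}\<close>.\<close>

definition cylinder :: "(nat \<Rightarrow> 'a) \<Rightarrow> nat \<Rightarrow> (nat \<Rightarrow> 'a) set" where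
  "cylinder x k = {z. \<forall>i<k. z i = x i}"

lemma mem_cylinder_self [simp]: "x \<in> cylinder x k"
  by (simp add: cylinder_def)

text \<open>A basic box restricts only finitely many coordinates, so some \<open>k\<close> exceeds
  all of them, and agreement below \<open>k\<close> already forces membership in the box.\<close>

lemma openin_seq_top:
  "openin seq_top U \<longleftrightarrow> (\<forall>x\<in>U. \<exists>k. cylinder x k \<subseteq> U)"
proof
  assume U: "openin seq_top U"
  show "\<forall>x\<in>U. \<exists>k. cylinder x k \<subseteq> U"
  proof
    fix x assume "x \<in> U"
    with U obtain V where V: "finite {i. V i \<noteq> UNIV}" "x \<in> Pi\<^sub>E UNIV V" "Pi\<^sub>E UNIV V \<subseteq> U"
      by (force simp: openin_product_topology_alt)
    then obtain k where k: "\<And>i. V i \<noteq> UNIV \<Longrightarrow> i < k"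
      by (auto simp: finite_nat_set_iff_bounded)
    have "cylinder x k \<subseteq> Pi\<^sub>E UNIV V"
    proof
      fix z assume z: "z \<in> cylinder x k"
      have "z i \<in> V i" for i
        using z k[of i] V(2) by (cases "i < k") (auto simp: cylinder_def PiE_iff)
      then show "z \<in> Pi\<^sub>E UNIV V" by auto
    qed
    with V(3) show "\<exists>k. cylinder x k \<subseteq> U" by blast
  qed
next
  assume R: "\<forall>x\<in>U. \<exists>k. cylinder x k \<subseteq> U"
  show "openin seq_top U"
    unfolding openin_product_topology_alt
  proof
    fix x assume "x \<in> U"
    with R obtain k where k: "cylinder x k \<subseteq> U" by blast
    let ?V = "\<lambda>i. if i < k then {x i} else UNIV"
    have "Pi\<^sub>E UNIV ?V \<subseteq> cylinder x k"
    proof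
      fix z assume z: "z \<in> Pi\<^sub>E UNIV ?V"
      have "z i = x i" if "i < k" for i
        using PiE_mem[OF z, of i] that by auto
      then show "z \<in> cylinder x k" by (simp add: cylinder_def)
    qed
    moreover have "finite {i. ?V i \<noteq> UNIV}"
      by (rule finite_subset[of _ "{..<k}"]) auto
    ultimately show "\<exists>V. finite {i \<in> UNIV. V i \<noteq> topspace (discrete_topology UNIV)} \<and>
        (\<forall>i\<in>UNIV. openin (discrete_topology UNIV) (V i)) \<and> x \<in> Pi\<^sub>E UNIV V \<and> Pi\<^sub>E UNIV V \<subseteq> U"
      using k by (intro exI[of _ ?V]) auto
  qed
qed

lemma openin_cylinder: "openin seq_top (cylinder x k)"
  unfolding openin_seq_top cylinder_def by (auto intro!: exI[of _ k])

text \<open>A cylinder is determined by its finite prefix, and over a countable alphabet there are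
  countably many lists.\<close>

lemma countable_cylinders: "countable {cylinder (x :: nat \<Rightarrow> 'a::countable) k | x k. True}"
proof (rule countable_subset)
  show "{cylinder x k | x k. True} \<subseteq> range (\<lambda>l :: 'a list. {z. \<forall>i<length l. z i = l ! i})"
  proof safe
    fix x :: "nat \<Rightarrow> 'a" and k
    show "cylinder x k \<in> range (\<lambda>l. {z. \<forall>i<length l. z i = l ! i})"
      by (rule range_eqI[of _ _ "map x [0..<k]"]) (auto simp: cylinder_def)
  qed
qed simp

lemma Polish_space_seq_top: "Polish_space (seq_top :: (nat \<Rightarrow> 'a::countable) topology)"
  unfolding Polish_space_def
proof
  show "completely_metrizable_space (seq_top :: (nat \<Rightarrow> 'a) topology)"
    by (simp add: completely_metrizable_space_product_topology
        completely_metrizable_space_discrete_topology)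
  show "second_countable (seq_top :: (nat \<Rightarrow> 'a) topology)"
    unfolding second_countable_def
  proof (intro exI conjI allI impI ballI)
    show "countable {cylinder (x :: nat \<Rightarrow> 'a) k | x k. True}"
      by (rule countable_cylinders)
  next
    fix V :: "(nat \<Rightarrow> 'a) set" assume "V \<in> {cylinder x k | x k. True}"
    then show "openin seq_top V" using openin_cylinder by auto
  next
    fix U :: "(nat \<Rightarrow> 'a) set" and x assume "openin seq_top U \<and> x \<in> U"
    then obtain k where "cylinder x k \<subseteq> U" by (auto simp: openin_seq_top)
    then show "\<exists>V\<in>{cylinder x k | x k. True}. x \<in> V \<and> V \<subseteq> U"
      by (intro bexI[of _ "cylinder x k"]) auto
  qed
qed

lemma space_seq_space [simp]: "space seq_space = UNIV"
  by (simp add: space_PiM)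

lemma cylinder_measurable [measurable]: "cylinder x k \<in> sets seq_space"
proof -
  have "{z \<in> space seq_space. \<forall>i\<in>{..<k}. z i = x i} \<in> sets seq_space"
    by measurable
  then show ?thesis by (simp add: cylinder_def lessThan_def)
qed

lemma sets_borel_of: "sets (borel_of T) = sigma_sets (topspace T) {U. openin T U}"
  unfolding borel_of_def by (intro sets_measure_of) (auto dest: openin_subset)

lemma space_borel_of: "space (borel_of T) = topspace T"
  unfolding borel_of_def by (intro space_measure_of) (auto dest: openin_subset)

lemma openin_imp_sets_borel_of: "openin T U \<Longrightarrow> U \<in> sets (borel_of T)"
  by (simp add: sets_borel_of)

text \<open>An open set is the union of the cylinders inside it, a countable union of measurable
  sets; conversely the generators of the product \<sigma>-algebra are open.\<close>

lemma sets_borel_of_seq_top: "sets (borel_of seq_top) = sets seq_space"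
proof
  have "U \<in> sets seq_space" if "openin seq_top U" for U
  proof -
    let ?C = "{C \<in> {cylinder x k | x k. True}. C \<subseteq> U}"
    have "U = \<Union>?C"
    proof
      show "U \<subseteq> \<Union>?C"
      proof
        fix x assume "x \<in> U"
        with that obtain k where "cylinder x k \<subseteq> U" unfolding openin_seq_top by blast
        then show "x \<in> \<Union>?C" by (intro UnionI[of "cylinder x k"]) auto
      qed
    qed blast
    moreover have "countable ?C"
      by (rule countable_subset[OF _ countable_cylinders]) auto
    then have "\<Union>?C \<in> sets seq_space"
      by (intro sets.countable_Union) auto
    ultimately show ?thesis by simp
  qed
  then show "sets (borel_of seq_top) \<subseteq> sets seq_space"
    unfolding sets_borel_of
    using sets.sigma_sets_subset[of "{U. openin seq_top U}" seq_space] by auto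
  \<comment> \<open>Membership depends on coordinate \<open>i\<close> alone, which a cylinder of
    length \<open>Suc i\<close> fixes.\<close>
  have "{f. f i \<in> A} \<in> sets (borel_of seq_top)" for i :: nat and A :: "bool set"
  proof (rule openin_imp_sets_borel_of)
    show "openin seq_top {f. f i \<in> A}"
      unfolding openin_seq_top cylinder_def by (auto intro!: exI[of _ "Suc i"])
  qed
  then show "sets seq_space \<subseteq> sets (borel_of seq_top)"
    unfolding sets_PiM_single
    using sets.sigma_sets_subset[of "{{f \<in> \<Pi>\<^sub>E i\<in>UNIV. space (count_space UNIV). f i \<in> A} |i A.
        i \<in> UNIV \<and> A \<in> sets (count_space UNIV)}" "borel_of (seq_top :: (nat \<Rightarrow> bool) topology)"]
    by (auto simp: space_borel_of)
qed

section \<open>Coin-tossing measures\<close>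

lemma space_coin_measure [simp]: "space (coin_measure p) = UNIV"
  by (simp add: coin_measure_def space_PiM)

lemma prob_space_coin_measure: "prob_space (coin_measure p)"
  unfolding coin_measure_def by (intro prob_space_PiM prob_space_measure_pmf)

lemma sets_sum_coin_measure [simp, measurable_cong]: "sets (sum_coin_measure p) = sets seq_space"
proof -
  have "sets seq_space \<subseteq> Pow UNIV" by auto
  then show ?thesis
    unfolding sum_coin_measure_def using sets.sigma_sets_eq[of seq_space] by simp
qed

lemma space_sum_coin_measure [simp]: "space (sum_coin_measure p) = UNIV"
  using sets_eq_imp_space_eq[OF sets_sum_coin_measure[of p]] by simp

declare sets_coin_measure [simp, measurable_cong]

lemma null_sets_sum_coin_measure:
  assumes "A \<in> sets seq_space" "\<And>n. emeasure (coin_measure (p n)) A = 0"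
  shows "A \<in> null_sets (sum_coin_measure p)"
  using assms by (auto simp: null_sets_def emeasure_sum_coin_measure)

lemma emeasure_coin_measure_cylinder:
  "emeasure (coin_measure p) (cylinder x k) = (\<Prod>i<k. ennreal (pmf (bernoulli_pmf p) (x i)))"
proof -
  interpret product_prob_space "\<lambda>_::nat. measure_pmf (bernoulli_pmf p)" UNIV
    by unfold_locales
  have "cylinder x k = {z \<in> space (coin_measure p). \<forall>i\<in>{..<k}. z i \<in> {x i}}"
    by (auto simp: cylinder_def)
  then show ?thesis
    using emeasure_PiM_Collect[of "{..<k}" "\<lambda>i. {x i}"]
    by (simp add: coin_measure_def emeasure_pmf_single)
qed

lemma emeasure_coin_measure_cylinder_ge:
  assumes "0 \<le> c" "c \<le> p" "c \<le> 1 - p"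
  shows "ennreal (c ^ k) \<le> emeasure (coin_measure p) (cylinder x k)"
proof -
  have "c ^ k = (\<Prod>i<k. c)" by simp
  also have "ennreal \<dots> = (\<Prod>i<k. ennreal c)"
    using assms by (subst prod_ennreal) auto
  also have "\<dots> \<le> emeasure (coin_measure p) (cylinder x k)"
    unfolding emeasure_coin_measure_cylinder
  proof (intro prod_mono_ennreal ennreal_leI)
    fix i show "c \<le> pmf (bernoulli_pmf p) (x i)"
      using assms by (cases "x i") auto
  qed
  finally show ?thesis .
qed

text \<open>Each factor in the measure of a cylinder is at most \<open>max p (1 - p) < 1\<close>, so
  the cylinders shrinking to \<open>x\<close> have geometrically decaying measure.\<close>

lemma emeasure_coin_measure_singleton:
  assumes "0 < p" "p < 1"
  shows "emeasure (coin_measure p) {x} = 0"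
proof -
  define c where "c = max p (1 - p)"
  have c: "0 \<le> c" "c < 1" using assms by (auto simp: c_def)
  have le: "emeasure (coin_measure p) {x} \<le> ennreal (c ^ k)" for k
  proof -
    have "emeasure (coin_measure p) {x} \<le> emeasure (coin_measure p) (cylinder x k)"
      by (intro emeasure_mono) auto
    also have "\<dots> \<le> (\<Prod>i<k. ennreal c)"
      unfolding emeasure_coin_measure_cylinder
    proof (intro prod_mono_ennreal ennreal_leI)
      fix i show "pmf (bernoulli_pmf p) (x i) \<le> c"
        using assms by (cases "x i") (auto simp: c_def)
    qed
    also have "\<dots> = ennreal (c ^ k)" using c by (simp add: ennreal_power)
    finally show ?thesis .
  qed
  have "(\<lambda>k. ennreal (c ^ k)) \<longlonglongrightarrow> ennreal 0"
    using c by (intro tendsto_ennrealI LIMSEQ_realpow_zero) auto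
  then have "emeasure (coin_measure p) {x} \<le> ennreal 0"
    by (rule LIMSEQ_le_const) (use le in auto)
  then show ?thesis by simp
qed

lemma singleton_measurable_seq_space: "{x} \<in> sets seq_space"
proof -
  have "{x} = (\<Inter>k. cylinder x k)"
    by (auto simp: cylinder_def)
  also have "\<dots> \<in> sets seq_space" by measurable
  finally show ?thesis .
qed

section \<open>The conull set of sequences with infinitely many 0s and 1s; infinite measure of
  cylinders\<close>

definition both_infinite :: "(nat \<Rightarrow> bool) set" where
  "both_infinite = {x. infinite {i. x i} \<and> infinite {i. \<not> x i}}"

text \<open>The exceptional sequences are the indicators of finite and of cofinite sets. Being
  countably many, they are negligible for every atomless measure.\<close>

lemma countable_not_both_infinite: "countable (- both_infinite)"
proof (rule countable_subset)
  show "- both_infinite \<subseteq> (\<lambda>A i. i \<in> A) ` {A. finite A} \<union> (\<lambda>A i. i \<notin> A) ` {A. finite A}"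
  proof
    fix x :: "nat \<Rightarrow> bool" assume "x \<in> - both_infinite"
    then consider "finite {i. x i}" | "finite {i. \<not> x i}" by (auto simp: both_infinite_def)
    then show "x \<in> (\<lambda>A i. i \<in> A) ` {A. finite A} \<union> (\<lambda>A i. i \<notin> A) ` {A. finite A}"
    proof cases
      case 1
      then have "x \<in> (\<lambda>A i. i \<in> A) ` {A. finite A}"
        by (intro image_eqI[of _ _ "{i. x i}"]) auto
      then show ?thesis by blast
    next
      case 2
      then have "x \<in> (\<lambda>A i. i \<notin> A) ` {A. finite A}"
        by (intro image_eqI[of _ _ "{i. \<not> x i}"]) auto
      then show ?thesis by blast
    qed
  qed
qed (simp add: countable_Collect_finite)

lemma both_infinite_conull:
  assumes "\<And>n. p n \<in> {0<..<1}"
  shows "- both_infinite \<in> null_sets (sum_coin_measure p)"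
proof -
  have "{x} \<in> null_sets (sum_coin_measure p)" for x
    using assms
    by (intro null_sets_sum_coin_measure singleton_measurable_seq_space
        emeasure_coin_measure_singleton) auto
  then have "(\<Union>x\<in>- both_infinite. {x}) \<in> null_sets (sum_coin_measure p)"
    by (intro null_sets_UN' countable_not_both_infinite)
  then show ?thesis by simp
qed

lemma emeasure_sum_coin_measure_cylinder:
  assumes "p \<longlonglongrightarrow> 1 / 2"
  shows "emeasure (sum_coin_measure p) (cylinder x k) = \<infinity>"
proof -
  let ?\<mu> = "\<lambda>n. emeasure (coin_measure (p n)) (cylinder x k)"
  \<comment> \<open>Once \<open>p n\<close> lies in (1/4, 3/4), both letters have probability at
    least 1/4, so a cylinder of length \<open>k\<close> has measure at least
    \<open>(1 / 4) ^ k\<close>, uniformly in \<open>n\<close>.\<close>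
  have "\<forall>\<^sub>F n in sequentially. p n > 1 / 4" "\<forall>\<^sub>F n in sequentially. p n < 3 / 4"
    by (rule order_tendstoD[OF assms]; simp)+
  then have "\<forall>\<^sub>F n in sequentially. ennreal ((1 / 4) ^ k) \<le> ?\<mu> n"
    by eventually_elim (auto intro!: emeasure_coin_measure_cylinder_ge)
  then obtain N where N: "\<And>n. n \<ge> N \<Longrightarrow> ennreal ((1 / 4) ^ k) \<le> ?\<mu> n"
    by (auto simp: eventually_sequentially)
  \<comment> \<open>A series with constant positive term diverges; shifting by \<open>N\<close>
    discards the finitely many indices where the bound may fail.\<close>
  have "\<infinity> = (\<Sum>n. ennreal ((1 / 4) ^ k))"
    by (simp add: nn_integral_count_space_nat[symmetric] ennreal_mult_top)
  also have "\<dots> \<le> (\<Sum>n. ?\<mu> (n + N))"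
    by (intro suminf_le N) auto
  also have "\<dots> \<le> (\<Sum>n. ?\<mu> n)"
    by (subst (2) suminf_offset[where i = N]) auto
  finally show ?thesis
    by (simp add: emeasure_sum_coin_measure top_unique)
qed

section \<open>Strong law of large numbers and \<sigma>-finiteness\<close>

lemma AE_coin_measure_frequency:
  assumes "0 \<le> p" "p \<le> 1"
  shows "AE x in coin_measure p. (\<lambda>k. (\<Sum>i<k. of_bool (x i)) / real k) \<longlonglongrightarrow> p"
proof -
  interpret C: prob_space "coin_measure p" by (rule prob_space_coin_measure)
  have comp: "distr (coin_measure p) (count_space UNIV) (\<lambda>x. x i) = measure_pmf (bernoulli_pmf p)" for i
  proof -
    have "distr (coin_measure p) (count_space UNIV) (\<lambda>x. x i) =
        distr (coin_measure p) (measure_pmf (bernoulli_pmf p)) (\<lambda>x. x i)"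
      by (intro distr_cong) auto
    then show ?thesis
      using distr_PiM_component[of UNIV "\<lambda>_. measure_pmf (bernoulli_pmf p)" i]
      by (simp add: coin_measure_def prob_space_measure_pmf)
  qed
  let ?X = "\<lambda>i x. of_bool (x i) :: real"
  \<comment> \<open>Independence says that the joint law is the product of the marginals. The joint
    map of all coordinates is the identity, so this is the definition of
    \<open>coin_measure\<close>.\<close>
  have indep0: "C.indep_vars (\<lambda>_. count_space UNIV) (\<lambda>i x. x i) UNIV"
  proof (subst C.indep_vars_iff_distr_eq_PiM)
    show "distr (coin_measure p) seq_space (\<lambda>x. \<lambda>i\<in>UNIV. x i) =
        (\<Pi>\<^sub>M i\<in>UNIV. distr (coin_measure p) (count_space UNIV) (\<lambda>x. x i))"
      unfolding comp
      by (simp add: coin_measure_def[symmetric] distr_id2 restrict_UNIV sets_coin_measure)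
  qed simp_all
  have indep: "C.indep_vars (\<lambda>_. borel) ?X UNIV"
    by (rule C.indep_vars_compose2[OF indep0]) simp
  have ex: "C.expectation (?X i) = p" for i
  proof -
    have "C.expectation (?X i) =
        integral\<^sup>L (distr (coin_measure p) (count_space UNIV) (\<lambda>x. x i)) of_bool"
      by (subst integral_distr) auto
    also have "\<dots> = p" unfolding comp using assms by simp
    finally show ?thesis .
  qed
  \<comment> \<open>Hoeffding's inequality makes the probabilities of deviations of size
    \<open>e * real k\<close> decay geometrically in \<open>k\<close>; by Borel-Cantelli almost
    surely only finitely many of them occur.\<close>
  have dev: "AE x in coin_measure p. \<forall>\<^sub>F k in sequentially. \<bar>(\<Sum>i<k. ?X i x) - real k * p\<bar> < e * real k"
    if e: "e > 0" for e
  proof -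
    let ?A = "\<lambda>k. {x \<in> space (coin_measure p). \<bar>(\<Sum>i<k. ?X i x) - real k * p\<bar> \<ge> e * real k}"
    have A: "?A k \<in> sets (coin_measure p)" for k by measurable
    have bound: "C.prob (?A k) \<le> 2 * exp (- 2 * e\<^sup>2) ^ k" for k
    \<comment> \<open>At \<open>k = 0\<close> the exponent in Hoeffding's bound would divide by
      zero. There the claimed bound equals 2, so the trivial bound 1 suffices.\<close>
    proof (cases "k = 0")
      case True
      have "C.prob (?A k) \<le> 1" by simp
      also have "\<dots> \<le> 2 * exp (- 2 * e\<^sup>2) ^ k" using True by simp
      finally show ?thesis .
    next
      case False
      \<comment> \<open>Each variable lies in [0,1], so the squared widths sum to \<open>k\<close>,
        the denominator in the exponent below.\<close>
      interpret H: Hoeffding_ineq "coin_measure p" "{..<k}" ?X "\<lambda>_. 0" "\<lambda>_. 1"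
          "\<Sum>i<k. C.expectation (?X i)"
        by unfold_locales (auto intro: C.indep_vars_subset[OF indep])
      have "C.prob (?A k) \<le> 2 * exp (- 2 * (e * real k)\<^sup>2 / real k)"
        using H.Hoeffding_ineq_abs_ge[of "e * real k"] e False by (simp add: ex)
      also have "- 2 * (e * real k)\<^sup>2 / real k = real k * (- 2 * e\<^sup>2)"
        using False by (simp add: power2_eq_square)
      also have "exp (real k * (- 2 * e\<^sup>2)) = exp (- 2 * e\<^sup>2) ^ k"
        by (rule exp_of_nat_mult)
      finally show ?thesis .
    qed
    have "summable (\<lambda>k. C.prob (?A k))"
    proof (rule summable_comparison_test')
      show "summable (\<lambda>k. 2 * exp (- 2 * e\<^sup>2) ^ k)"
        using e by (intro summable_mult summable_geometric) auto
    qed (use bound in auto)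
    then have "AE x in coin_measure p. \<forall>\<^sub>F k in sequentially. x \<in> space (coin_measure p) - ?A k"
      using A by (intro borel_cantelli_AE1) (auto simp: C.emeasure_eq_measure)
    then show ?thesis
      by eventually_elim (auto elim!: eventually_mono)
  qed
  \<comment> \<open>Restricting \<open>e\<close> to the values \<open>inverse (real (Suc m))\<close>
    leaves countably many null sets to discard.\<close>
  have "AE x in coin_measure p. \<forall>m::nat. \<forall>\<^sub>F k in sequentially.
      \<bar>(\<Sum>i<k. ?X i x) - real k * p\<bar> < inverse (real (Suc m)) * real k"
    unfolding AE_all_countable using dev by simp
  then show ?thesis
  proof eventually_elim
    fix x assume x: "\<forall>m::nat. \<forall>\<^sub>F k in sequentially.
      \<bar>(\<Sum>i<k. ?X i x) - real k * p\<bar> < inverse (real (Suc m)) * real k"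
    show "(\<lambda>k. (\<Sum>i<k. ?X i x) / real k) \<longlonglongrightarrow> p"
    proof (rule tendstoI)
      fix e :: real assume "e > 0"
      then obtain m where m: "inverse (real (Suc m)) < e" using reals_Archimedean by blast
      show "\<forall>\<^sub>F k in sequentially. dist ((\<Sum>i<k. ?X i x) / real k) p < e"
        using x[rule_format, of m] eventually_gt_at_top[of 0]
      proof eventually_elim
        case (elim k)
        have "dist ((\<Sum>i<k. ?X i x) / real k) p = \<bar>(\<Sum>i<k. ?X i x) - real k * p\<bar> / real k"
          using elim by (simp add: dist_real_def field_simps)
        also have "\<dots> < inverse (real (Suc m))"
          using elim by (simp add: divide_less_eq)
        finally show ?case using m by linarith
      qed
    qed
  qed
qed

lemma sigma_finite_sum_coin_measure:
  assumes "inj p" and p: "\<And>n. p n \<in> {0<..<1}"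
  shows "sigma_finite_measure (sum_coin_measure p)"
proof -
  \<comment> \<open>The limsup exists for every sequence and equals the limiting frequency where
    there is one, so \<open>E n\<close> is measurable without a separate convergence
    condition.\<close>
  define F where "F x = limsup (\<lambda>k. ereal ((\<Sum>i<k. of_bool (x i)) / real k))" for x :: "nat \<Rightarrow> bool"
  have F [measurable]: "F \<in> borel_measurable seq_space"
    unfolding F_def by measurable
  define E where "E n = {x \<in> space seq_space. F x = ereal (p n)}" for n
  have E [measurable]: "E n \<in> sets seq_space" for n
    unfolding E_def by measurable
  have AE: "AE x in coin_measure (p n). x \<in> E n" for n
  proof -
    have "AE x in coin_measure (p n). (\<lambda>k. (\<Sum>i<k. of_bool (x i)) / real k) \<longlonglongrightarrow> p n"
      using p[of n] by (intro AE_coin_measure_frequency) auto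
    then show ?thesis
      by eventually_elim (auto simp: E_def F_def intro!: lim_imp_Limsup)
  qed
  have disj: "x \<notin> E m" if "x \<in> E n" "m \<noteq> n" for x m n
    using that \<open>inj p\<close> by (auto simp: E_def dest: injD)
  have zero: "emeasure (coin_measure (p m)) (E n) = 0" if "m \<noteq> n" for m n
  proof -
    have "AE x in coin_measure (p m). x \<notin> E n"
      using AE[of m] disj that by auto
    then show ?thesis by (subst (asm) AE_iff_measurable[of "E n"]) auto
  qed
  \<comment> \<open>On \<open>E n\<close> every summand except the \<open>n\<close>-th vanishes, and
    that one is a probability measure.\<close>
  have finite_E: "emeasure (sum_coin_measure p) (E n) \<noteq> \<infinity>" for n
  proof -
    have "(\<Sum>m. emeasure (coin_measure (p m)) (E n)) = (\<Sum>m\<in>{n}. emeasure (coin_measure (p m)) (E n))"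
      by (intro suminf_finite) (auto simp: zero)
    also have "\<dots> \<le> 1"
      using prob_space.emeasure_le_1[OF prob_space_coin_measure] by simp
    finally show ?thesis by (auto simp: emeasure_sum_coin_measure top_unique)
  qed
  \<comment> \<open>The sets \<open>E n\<close> need not cover the space; the remainder is null for
    every coin measure and completes the countable cover.\<close>
  let ?N = "UNIV - (\<Union>n. E n)"
  have N: "?N \<in> sets seq_space"
    using sets.compl_sets[of "\<Union>n. E n" seq_space] by auto
  have "?N \<in> null_sets (sum_coin_measure p)"
  proof (rule null_sets_sum_coin_measure[OF N])
    fix n
    have "AE x in coin_measure (p n). x \<notin> ?N"
      using AE[of n] by eventually_elim auto
    then show "emeasure (coin_measure (p n)) ?N = 0"
      using N by (subst (asm) AE_iff_measurable[of ?N]) auto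
  qed
  show ?thesis
  proof
    show "\<exists>A. countable A \<and> A \<subseteq> sets (sum_coin_measure p) \<and> \<Union>A = space (sum_coin_measure p) \<and>
        (\<forall>a\<in>A. emeasure (sum_coin_measure p) a \<noteq> \<infinity>)"
      using N \<open>?N \<in> null_sets _\<close> finite_E
      by (intro exI[of _ "insert ?N (range E)"]) auto
  qed
qed

section \<open>The permutation action\<close>

lemma perm_action_measurable: "perm_action \<sigma> \<in> seq_space \<rightarrow>\<^sub>M seq_space"
  unfolding perm_action_def by (intro measurable_PiM_single') auto

text \<open>All factors of the product are equal, so reindexing the coordinates along the injection
  \<open>inv \<sigma>\<close> gives back the same product.\<close>

lemma distr_coin_measure_perm_action:
  assumes "\<sigma> \<in> Sinf"
  shows "distr (coin_measure p) (coin_measure p) (perm_action \<sigma>) = coin_measure p"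
proof -
  have "inj (inv \<sigma>)"
    using assms by (simp add: Sinf_def bij_imp_bij_inv bij_is_inj)
  then show ?thesis
    using distr_PiM_reindex[of UNIV "\<lambda>_. measure_pmf (bernoulli_pmf p)" "inv \<sigma>" UNIV]
    by (simp add: coin_measure_def prob_space_measure_pmf perm_action_def[abs_def] restrict_UNIV)
qed

lemma mp_action_perm_action: "mp_action (sum_coin_measure p) perm_action"
  unfolding mp_action_def
proof (intro conjI ballI)
  fix \<sigma> assume \<sigma>: "\<sigma> \<in> Sinf"
  have meas [measurable]: "perm_action \<sigma> \<in> seq_space \<rightarrow>\<^sub>M seq_space"
    by (rule perm_action_measurable)
  show "perm_action \<sigma> \<in> sum_coin_measure p \<rightarrow>\<^sub>M sum_coin_measure p"
    by measurable
  show "distr (sum_coin_measure p) (sum_coin_measure p) (perm_action \<sigma>) = sum_coin_measure p"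
  proof (rule measure_eqI)
    fix A assume "A \<in> sets (distr (sum_coin_measure p) (sum_coin_measure p) (perm_action \<sigma>))"
    then have A: "A \<in> sets seq_space" by simp
    then have A': "perm_action \<sigma> -` A \<in> sets seq_space"
      using measurable_sets[OF meas] by simp
    \<comment> \<open>Invariance holds for each summand separately, hence for the sum.\<close>
    have "emeasure (coin_measure q) (perm_action \<sigma> -` A) = emeasure (coin_measure q) A" for q
      using A arg_cong[OF distr_coin_measure_perm_action[OF \<sigma>, of q], of "\<lambda>M. emeasure M A"]
      by (subst (asm) emeasure_distr) auto
    then show "emeasure (distr (sum_coin_measure p) (sum_coin_measure p) (perm_action \<sigma>)) A =
        emeasure (sum_coin_measure p) A"
      using A A' by (subst emeasure_distr) (auto simp: emeasure_sum_coin_measure)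
  qed simp
next
  fix x :: "nat \<Rightarrow> bool"
  show "perm_action id x = x" by (simp add: perm_action_def)
  \<comment> \<open>Inversion and precomposition both reverse the order of composition; the two
    reversals cancel, giving a left action.\<close>
  fix g h assume "g \<in> Sinf" "h \<in> Sinf"
  then show "perm_action (g \<circ> h) x = perm_action g (perm_action h x)"
    by (simp add: perm_action_def Sinf_def o_inv_distrib)
qed

lemma topspace_Sinf_top [simp]: "topspace Sinf_top = Sinf"
  by (simp add: Sinf_top_def)

lemma Sinf_eval_measurable: "{g \<in> Sinf. g j = i} \<in> sets (borel_of Sinf_top)"
proof -
  have "openin seq_top {g :: nat \<Rightarrow> nat. g j = i}"
    unfolding openin_seq_top cylinder_def by (auto intro!: exI[of _ "Suc j"])
  then have "openin Sinf_top ({g. g j = i} \<inter> Sinf)"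
    unfolding Sinf_top_def by (auto simp: openin_subtopology)
  also have "{g. g j = i} \<inter> Sinf = {g \<in> Sinf. g j = i}" by auto
  finally show ?thesis by (rule openin_imp_sets_borel_of)
qed

lemma perm_action_jointly_measurable:
  "(\<lambda>(g, x). perm_action g x) \<in> borel_of Sinf_top \<Otimes>\<^sub>M seq_space \<rightarrow>\<^sub>M seq_space"
proof (rule measurable_PiM_single)
  let ?P = "borel_of Sinf_top \<Otimes>\<^sub>M seq_space"
  fix i :: nat and A :: "bool set"
  \<comment> \<open>Splitting according to the value \<open>j = inv g i\<close> avoids the inverse:
    \<open>inv g i = j\<close> becomes \<open>g j = i\<close>, and the set is a countable union of
    measurable rectangles.\<close>
  have "{w \<in> space ?P. (case w of (g, x) \<Rightarrow> perm_action g x) i \<in> A} =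
      (\<Union>j. {g \<in> Sinf. g j = i} \<times> {x. x j \<in> A})"
    by (auto simp: space_pair_measure space_borel_of perm_action_def Sinf_def bij_is_inj
        intro: exI[of _ "inv _ i"] bij_inv_eq_iff[THEN iffD1, OF _ refl])
  also have "\<dots> \<in> sets ?P"
  proof (rule sets.countable_UN)
    have "{x \<in> space seq_space. x j \<in> A} \<in> sets seq_space" for j by measurable
    then show "range (\<lambda>j. {g \<in> Sinf. g j = i} \<times> {x. x j \<in> A}) \<subseteq> sets ?P"
      using Sinf_eval_measurable by auto
  qed
  finally show "{w \<in> space ?P. (case w of (g, x) \<Rightarrow> perm_action g x) i \<in> A} \<in> sets ?P" .
qed auto

lemma spatial_action_perm_action:
  assumes "inj p" "\<And>n. p n \<in> {0<..<1}"
  shows "spatial_action (sum_coin_measure p) perm_action"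
  unfolding spatial_action_def
proof (intro conjI mp_action_perm_action sigma_finite_sum_coin_measure assms)
  show "standard_borel (sum_coin_measure p)"
    unfolding standard_borel_def
    using Polish_space_seq_top sets_borel_of_seq_top by (intro exI[of _ seq_top]) auto
  have "sets (borel_of Sinf_top \<Otimes>\<^sub>M sum_coin_measure p) = sets (borel_of Sinf_top \<Otimes>\<^sub>M seq_space)"
    by (intro sets_pair_measure_cong) auto
  then show "(\<lambda>(g, x). perm_action g x) \<in>
      borel_of Sinf_top \<Otimes>\<^sub>M sum_coin_measure p \<rightarrow>\<^sub>M sum_coin_measure p"
    using perm_action_jointly_measurable by (subst measurable_cong_sets) auto
qed

section \<open>Orbits of stabilisers and the contradiction\<close>

lemma ex_bij_betw_infinite_nat:
  fixes A B :: "nat set"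
  assumes "infinite A" "infinite B"
  shows "\<exists>f. bij_betw f A B"
  \<comment> \<open>Match the n-th element of \<open>A\<close> with the n-th element of
    \<open>B\<close>.\<close>
  using bij_betw_trans[OF bij_betw_inv_into[OF bij_enumerate[OF assms(1)]] bij_enumerate[OF assms(2)]]
  by (rule exI[of "\<lambda>f. bij_betw f A B"])

text \<open>Fix \<open>{..<k}\<close> pointwise, where \<open>x\<close> and \<open>z\<close> agree,
  and beyond \<open>k\<close> match the 1s of \<open>x\<close> with the 1s of \<open>z\<close> and
  the 0s with the 0s; all these sets are infinite, hence equipotent.\<close>

lemma both_infinite_cylinder_orbit:
  assumes x: "x \<in> both_infinite" and z: "z \<in> both_infinite" "z \<in> cylinder x k"
  obtains g where "g \<in> Sinf" "g \<in> cylinder id k" "perm_action g x = z"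
proof -
  have inf: "infinite {i. k \<le> i \<and> y i = b}" if "y \<in> both_infinite" for y b
  proof
    assume "finite {i. k \<le> i \<and> y i = b}"
    then have "finite ({i. k \<le> i \<and> y i = b} \<union> {..<k})" by simp
    then have "finite {i. y i = b}" by (rule rev_finite_subset) auto
    with that show False by (cases b) (auto simp: both_infinite_def)
  qed
  obtain f1 where f1: "bij_betw f1 {i. k \<le> i \<and> x i = True} {i. k \<le> i \<and> z i = True}"
    using ex_bij_betw_infinite_nat[OF inf[OF x, of True] inf[OF z(1), of True]] by blast
  obtain f0 where f0: "bij_betw f0 {i. k \<le> i \<and> x i = False} {i. k \<le> i \<and> z i = False}"
    using ex_bij_betw_infinite_nat[OF inf[OF x, of False] inf[OF z(1), of False]] by blast
  define g where "g i = (if i < k then i else if x i then f1 i else f0 i)" for i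
  have g0: "bij_betw g {..<k} {..<k}"
    using bij_betw_id[of "{..<k}"] by (subst bij_betw_cong[of _ g id]) (auto simp: g_def)
  have g1: "bij_betw g {i. k \<le> i \<and> x i = True} {i. k \<le> i \<and> z i = True}"
    using f1 by (subst bij_betw_cong[of _ g f1]) (auto simp: g_def)
  have g2: "bij_betw g {i. k \<le> i \<and> x i = False} {i. k \<le> i \<and> z i = False}"
    using f0 by (subst bij_betw_cong[of _ g f0]) (auto simp: g_def)
  have "bij_betw g ({..<k} \<union> ({i. k \<le> i \<and> x i = True} \<union> {i. k \<le> i \<and> x i = False}))
      ({..<k} \<union> ({i. k \<le> i \<and> z i = True} \<union> {i. k \<le> i \<and> z i = False}))"
    by (intro bij_betw_combine g0 g1 g2) auto
  also have "{..<k} \<union> ({i. k \<le> i \<and> x i = True} \<union> {i. k \<le> i \<and> x i = False}) = UNIV" by auto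
  also have "{..<k} \<union> ({i. k \<le> i \<and> z i = True} \<union> {i. k \<le> i \<and> z i = False}) = UNIV" by auto
  finally have bij: "bij g" .
  \<comment> \<open>Written without \<open>inv g\<close>, this is
    \<open>perm_action g x = z\<close>.\<close>
  have zg: "z (g i) = x i" for i
    using bij_betwE[OF g1] bij_betwE[OF g2] z(2)
    by (cases "i < k"; cases "x i") (auto simp: g_def cylinder_def)
  have "perm_action g x = z"
    using zg[of "inv g _"] bij by (auto simp: perm_action_def bij_is_surj surj_f_inv_f fun_eq_iff)
  then show ?thesis
    using that[of g] bij by (auto simp: Sinf_def g_def cylinder_def)
qed

text \<open>The orbit map of \<open>y\<close> is continuous, so the preimage of \<open>U\<close> is
  a neighbourhood of \<open>id\<close> and contains some stabiliser. No action law is assumed here,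
  hence \<open>\<beta> id y\<close> in place of \<open>y\<close>.\<close>

lemma continuous_action_stabilizer:
  assumes "continuous_action Y \<beta>" "openin Y U" "y \<in> topspace Y" "\<beta> id y \<in> U"
  obtains k where "\<And>g. g \<in> Sinf \<Longrightarrow> g \<in> cylinder id k \<Longrightarrow> \<beta> g y \<in> U"
proof -
  have "continuous_map Sinf_top (prod_topology Sinf_top Y) (\<lambda>g. (g, y))"
    using assms(3) by (intro continuous_map_pairedI) auto
  then have "continuous_map Sinf_top Y ((\<lambda>(g, y). \<beta> g y) \<circ> (\<lambda>g. (g, y)))"
    using assms(1) unfolding continuous_action_def by (rule continuous_map_compose)
  then have "openin Sinf_top {g \<in> topspace Sinf_top. ((\<lambda>(g, y). \<beta> g y) \<circ> (\<lambda>g. (g, y))) g \<in> U}"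
    using assms(2) by (rule openin_continuous_map_preimage)
  then have "openin Sinf_top {g \<in> Sinf. \<beta> g y \<in> U}" by simp
  then obtain V where V: "openin seq_top V" "{g \<in> Sinf. \<beta> g y \<in> U} = V \<inter> Sinf"
    unfolding Sinf_top_def openin_subtopology by blast
  have "id \<in> V" using V(2) assms(4) by (auto simp: Sinf_def)
  with V(1) obtain k where "cylinder id k \<subseteq> V" unfolding openin_seq_top by blast
  then show ?thesis using that[of k] V(2) by blast
qed

lemma not_spatially_isomorphic_continuous:
  assumes p: "\<And>n. p n \<in> {0<..<1}" "p \<longlonglongrightarrow> 1 / 2"
    and \<eta>: "sets \<eta> = sets (borel_of Y)" "locally_finite_measure Y \<eta>"
    and \<beta>: "mp_action \<eta> \<beta>" "continuous_action Y \<beta>"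
  shows "\<not> spatially_isomorphic (sum_coin_measure p) perm_action \<eta> \<beta>"
proof
  let ?M = "sum_coin_measure p"
  assume "spatially_isomorphic ?M perm_action \<eta> \<beta>"
  then obtain X0 \<Phi> where X0: "X0 \<in> sets ?M" "space ?M - X0 \<in> null_sets ?M"
      "\<forall>g\<in>Sinf. perm_action g ` X0 = X0"
    and \<Phi>: "\<Phi> \<in> restrict_space ?M X0 \<rightarrow>\<^sub>M \<eta>" "distr (restrict_space ?M X0) \<eta> \<Phi> = \<eta>"
      "\<forall>g\<in>Sinf. \<forall>x\<in>X0. \<Phi> (perm_action g x) = \<beta> g (\<Phi> x)"
    unfolding spatially_isomorphic_def by (elim exE conjE) (rule that)
  have space_\<eta>: "space \<eta> = topspace Y"
    using sets_eq_imp_space_eq[OF \<eta>(1)] by (simp add: space_borel_of)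
  have null: "- both_infinite \<in> null_sets ?M"
    using p(1) by (rule both_infinite_conull)
  \<comment> \<open>Two conull sets meet because the whole space, the cylinder of length 0, is not
    null.\<close>
  have "X0 \<inter> both_infinite \<noteq> {}"
  proof
    assume "X0 \<inter> both_infinite = {}"
    then have "UNIV = (space ?M - X0) \<union> - both_infinite" by auto
    then have "UNIV \<in> null_sets ?M" using null_sets.Un[OF X0(2) null] by simp
    moreover have "UNIV = cylinder (\<lambda>_. True) 0" by (simp add: cylinder_def)
    ultimately show False
      using emeasure_sum_coin_measure_cylinder[OF p(2), of "\<lambda>_. True" 0] by auto
  qed
  then obtain x where x: "x \<in> X0" "x \<in> both_infinite" by blast
  have \<Phi>_x: "\<Phi> x \<in> topspace Y"
    using measurable_space[OF \<Phi>(1), of x] x(1) by (simp add: space_\<eta> space_restrict_space)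
  then obtain U where U: "openin Y U" "\<Phi> x \<in> U" "emeasure \<eta> U < \<infinity>"
    using \<eta>(2) unfolding locally_finite_measure_def by blast
  have "\<beta> id (\<Phi> x) = \<Phi> x" using \<beta>(1) \<Phi>_x by (auto simp: mp_action_def space_\<eta>)
  then obtain k where k: "\<And>g. g \<in> Sinf \<Longrightarrow> g \<in> cylinder id k \<Longrightarrow> \<beta> g (\<Phi> x) \<in> U"
    using continuous_action_stabilizer[OF \<beta>(2) U(1) \<Phi>_x] U(2) by auto
  \<comment> \<open>Such a \<open>z\<close> is \<open>perm_action g x\<close> with \<open>g\<close>
    fixing \<open>{..<k}\<close>: invariance of \<open>X0\<close> puts \<open>z\<close> in
    \<open>X0\<close>, and equivariance turns \<open>\<Phi> z\<close> into
    \<open>\<beta> g (\<Phi> x)\<close>, which lies in \<open>U\<close> by the choice of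
    \<open>k\<close>.\<close>
  have sub: "cylinder x k \<inter> both_infinite \<subseteq> \<Phi> -` U \<inter> X0"
  proof
    fix z assume "z \<in> cylinder x k \<inter> both_infinite"
    then obtain g where g: "g \<in> Sinf" "g \<in> cylinder id k" "perm_action g x = z"
      using both_infinite_cylinder_orbit[OF x(2), of z k] by auto
    have "z \<in> X0" using bspec[OF X0(3) g(1)] g(3) x(1) by blast
    moreover have "\<Phi> z \<in> U" using bspec[OF bspec[OF \<Phi>(3) g(1)] x(1)] g(3) k[OF g(1,2)] by simp
    ultimately show "z \<in> \<Phi> -` U \<inter> X0" by simp
  qed
  have U_sets: "U \<in> sets \<eta>" using U(1) \<eta>(1) openin_imp_sets_borel_of by metis
  have "\<Phi> -` U \<inter> X0 \<in> sets (restrict_space ?M X0)"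
    using measurable_sets[OF \<Phi>(1) U_sets] by (simp add: space_restrict_space)
  then have pre: "\<Phi> -` U \<inter> X0 \<in> sets ?M"
    using X0(1) by (subst (asm) sets_restrict_space_iff) auto
  \<comment> \<open>Removing a null set costs nothing, and what remains lies in the preimage of
    \<open>U\<close>, whose measure is that of \<open>U\<close> under the pushforward
    \<open>\<eta>\<close>.\<close>
  have "emeasure ?M (cylinder x k) = emeasure ?M (cylinder x k - - both_infinite)"
    using null by (intro emeasure_Diff_null_set[symmetric]) auto
  also have "\<dots> \<le> emeasure ?M (\<Phi> -` U \<inter> X0)"
    using sub pre by (intro emeasure_mono) auto
  also have "\<dots> = emeasure (restrict_space ?M X0) (\<Phi> -` U \<inter> X0)"
    using X0(1) by (intro emeasure_restrict_space[symmetric]) auto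
  also have "\<dots> = emeasure (distr (restrict_space ?M X0) \<eta> \<Phi>) U"
    using emeasure_distr[OF \<Phi>(1) U_sets] by (simp add: space_restrict_space)
  also have "\<dots> < \<infinity>" using \<Phi>(2) U(3) by simp
  finally have "emeasure ?M (cylinder x k) < \<infinity>" .
  then show False
    by (simp add: emeasure_sum_coin_measure_cylinder[OF p(2)])
qed

theorem proposition5p10:
  fixes p :: "nat \<Rightarrow> real"
  assumes "inj p"
    and "\<And>n. p n \<in> {0<..<1}"
    and "p \<longlonglongrightarrow> 1 / 2"
  shows "emeasure (sum_coin_measure p) UNIV = \<infinity> \<and>
    spatial_action (sum_coin_measure p) perm_action \<and>
    \<not> (\<exists>(Y :: 'y topology) \<eta> \<beta>.
         Polish_space Y \<and> sets \<eta> = sets (borel_of Y) \<and> locally_finite_measure Y \<eta> \<and>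
         mp_action \<eta> \<beta> \<and> continuous_action Y \<beta> \<and>
         spatially_isomorphic (sum_coin_measure p) perm_action \<eta> \<beta>)"
proof (intro conjI)
  show "emeasure (sum_coin_measure p) UNIV = \<infinity>"
    using emeasure_sum_coin_measure_cylinder[OF assms(3), of undefined 0] by (simp add: cylinder_def)
  show "spatial_action (sum_coin_measure p) perm_action"
    using assms(1,2) by (rule spatial_action_perm_action)
  show "\<not> (\<exists>(Y :: 'y topology) \<eta> \<beta>.
         Polish_space Y \<and> sets \<eta> = sets (borel_of Y) \<and> locally_finite_measure Y \<eta> \<and>
         mp_action \<eta> \<beta> \<and> continuous_action Y \<beta> \<and>
         spatially_isomorphic (sum_coin_measure p) perm_action \<eta> \<beta>)"
    using not_spatially_isomorphic_continuous assms(2,3) by blast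
qed

end
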